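(* Let $\mathbf{y}=\mathbf{X}\boldsymbol{\beta}^*+\boldsymbol{\epsilon}$ with $\mathbf{X}\in\mathbb{R}^{n\times p}$, $\boldsymbol{\epsilon}\in\mathbb{R}^n$ and $\boldsymbol{\beta}^*\in\mathbb{R}^p$ $K$-sparse. Assume that the columns of $\mathbf{X}$ satisfy $\mathbf{X}_j^T\mathbf{X}_j=1$, that the restricted isometry constants of $\mathbf{X}$ satisfy $\delta_K\le\delta_{K+1}\le\delta_{2K}\le\delta_{4K}\le 0.1$, and that at every iteration $k$ of the CoSaOP algorithm $$\operatorname{supp}(\boldsymbol{\beta}^* )\subseteq\left(S_k\,\triangle\,\operatorname{supp}(\tilde{\mathbf{a}}_K)\right)^c ,$$ where $\mathbf{a}$ is the least-squares estimate on $U_k$ at iteration $k$ and $\tilde{\mathbf{a}}_K$ is the best $K$-sparse approximation of $\mathbf{a}$. Then the iterates of CoSaOP satisfy, for every iteration $k\ge 1$, $$\|\boldsymbol{\beta}^k-\boldsymbol{\beta}^*\|_2\le 0.869\,\|\boldsymbol{\beta}^{k-1}-\boldsymbol{\beta}^*\|_2+14.482\,\|\boldsymbol{\epsilon}\|_2 ,$$ i.e. the algorithm converges at a linear rate when the approximation error is large in comparison with the noise.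
   Context: Notation: for an index set $S\subset\{1,\dots,p\}$, $\mathbf{X}_S$ is the submatrix of columns of $\mathbf{X}$ indexed by $S$, $S^c$ its complement, $\mathbf{v}|_S$ the restriction of a vector $\mathbf{v}$ to $S$; $A\triangle B=(A\setminus B)\cup(B\setminus A)$. A vector is $K$-sparse if it has at most $K$ nonzero entries. The restricted isometry constant $\delta_r$ is the smallest number with $(1-\delta_r)\|\mathbf{x}\|_2^2\le\|\mathbf{X}\mathbf{x}\|_2^2\le(1+\delta_r)\|\mathbf{x}\|_2^2$ for all $\mathbf{x}\in\mathbb{R}^p$ with at most $r$ nonzero entries. The best $K$-sparse approximation $\tilde{\mathbf{a}}_K$ of $\mathbf{a}$ keeps $K$ entries of $\mathbf{a}$ of largest magnitude and sets the others to $0$. CoSaOP algorithm with sparsity level $K$: start with $S_0=\emptyset$, $\boldsymbol{\beta}^0=\mathbf{0}$, $\mathbf{r}^1=\mathbf{y}$. Iteration $k\ge1$: (i) (Identification) $\Omega$ is a set of $2K$ indices $j\in S_{k-1}^c$ with the largest values of $\dfrac{({\mathbf{r}^k}^T\mathbf{X}_j)^2}{\mathbf{X}_j^T(\mathbf{I}-\mathbf{X}_{S_{k-1}}(\mathbf{X}_{S_{k-1}}^T\mathbf{X}_{S_{k-1}})^{-1}\mathbf{X}_{S_{k-1}}^T)\mathbf{X}_j}$ (for $S_{k-1}=\emptyset$ the projection term is zero). (ii) (Merger) $U_k=S_{k-1}\cup\Omega$. The least-squares estimate $\mathbf{a}$ on $U_k$ is $\mathbf{a}|_{U_k}=(\mathbf{X}_{U_k}^T\mathbf{X}_{U_k})^{-1}\mathbf{X}_{U_k}^T\mathbf{y}$,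 $\mathbf{a}|_{U_k^c}=\mathbf{0}$. (iii) (Elimination) With $\mathbf{C}=(\mathbf{X}_{U_k}^T\mathbf{X}_{U_k})^{-1}$ and $\mathbf{e}_j$ the standard basis vector of $\mathbb{R}^{|U_k|}$ at the position of $j$ in $U_k$, $S_k$ is a set of $K$ indices $j\in U_k$ with the smallest values of $\mathbf{y}^T\mathbf{X}_{U_k}(\mathbf{I}-\mathbf{e}_j\mathbf{e}_j^T)\left(\mathbf{C}-\frac{\mathbf{C}\mathbf{e}_j\mathbf{e}_j^T\mathbf{C}}{\mathbf{e}_j^T\mathbf{C}\mathbf{e}_j}\right)(\mathbf{I}-\mathbf{e}_j\mathbf{e}_j^T)\mathbf{X}_{U_k}^T\mathbf{y}$. (iv) (Estimation) $\boldsymbol{\beta}^k|_{S_k}=(\mathbf{X}_{S_k}^T\mathbf{X}_{S_k})^{-1}\mathbf{X}_{S_k}^T\mathbf{y}$, $\boldsymbol{\beta}^k|_{S_k^c}=\mathbf{0}$, and $\mathbf{r}^{k+1}=\mathbf{y}-\mathbf{X}\boldsymbol{\beta}^k$. *)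

theory Defs
  imports "HOL-Analysis.Analysis"
begin

definition supp :: "real^'p \<Rightarrow> 'p set" where
  "supp v = {j. v $ j \<noteq> 0}"

definition sparse_vec :: "nat \<Rightarrow> real^'p \<Rightarrow> bool" where
  "sparse_vec K v \<longleftrightarrow> card (supp v) \<le> K"

text \<open>The restricted isometry constant of order \<open>r\<close>. The least number exists for \<open>r \<ge> 1\<close>;
  for \<open>r = 0\<close> every number qualifies and the value is unspecified.\<close>

definition ric :: "real^'p^'n \<Rightarrow> nat \<Rightarrow> real" where
  "ric X r = (LEAST d. \<forall>x. sparse_vec r x \<longrightarrow>
     (1 - d) * (norm x)\<^sup>2 \<le> (norm (X *v x))\<^sup>2 \<and>
     (norm (X *v x))\<^sup>2 \<le> (1 + d) * (norm x)\<^sup>2)"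

text \<open>The dimension of a matrix over an index set \<open>S\<close> depends on \<open>S\<close> and cannot be a type, so a
  matrix with rows or columns indexed by \<open>S\<close> is stored in the full index type with zero rows or
  columns outside \<open>S\<close>; sums and products then agree with those of the genuine submatrices. The
  identity on \<open>S\<close> becomes \<open>id_on S\<close>, and \<open>inverse_on S M\<close> is the inverse of the
  \<open>S\<close>-by-\<open>S\<close> matrix \<open>M\<close> (unspecified, like \<open>matrix_inv\<close>, if \<open>M\<close> is singular on \<open>S\<close>).\<close>

definition sub_cols :: "real^'p^'n \<Rightarrow> 'p set \<Rightarrow> real^'p^'n" where
  "sub_cols X S = (\<chi> i j. if j \<in> S then X $ i $ j else 0)"

definition id_on :: "'p set \<Rightarrow> real^'p^'p" where
  "id_on S = (\<chi> i j. if i = j \<and> i \<in> S then 1 else 0)"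

definition inverse_on :: "'p set \<Rightarrow> real^'p^'p \<Rightarrow> real^'p^'p" where
  "inverse_on S M = (SOME C. (\<forall>i j. i \<notin> S \<or> j \<notin> S \<longrightarrow> C $ i $ j = 0) \<and>
     M ** C = id_on S \<and> C ** M = id_on S)"

definition gram_inv :: "real^'p^'n \<Rightarrow> 'p set \<Rightarrow> real^'p^'p" where
  "gram_inv X S = inverse_on S (transpose (sub_cols X S) ** sub_cols X S)"

definition least_squares :: "real^'p^'n \<Rightarrow> real^'n \<Rightarrow> 'p set \<Rightarrow> real^'p" where
  "least_squares X y S =
     (\<chi> j. if j \<in> S then (gram_inv X S *v (transpose (sub_cols X S) *v y)) $ j else 0)"

definition outer :: "real^'p \<Rightarrow> real^'p \<Rightarrow> real^'p^'p" where
  "outer u v = (\<chi> i j. u $ i * v $ j)"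

text \<open>Ties may be broken arbitrarily: these are relations satisfied by every admissible choice
  \<open>T\<close> of \<open>m\<close> elements of \<open>A\<close> with the largest (smallest) values of \<open>f\<close>.\<close>

definition largest_in :: "nat \<Rightarrow> ('p \<Rightarrow> real) \<Rightarrow> 'p::finite set \<Rightarrow> 'p set \<Rightarrow> bool" where
  "largest_in m f A T \<longleftrightarrow> T \<subseteq> A \<and> card T = m \<and> (\<forall>i\<in>T. \<forall>j\<in>A - T. f j \<le> f i)"

definition smallest_in :: "nat \<Rightarrow> ('p \<Rightarrow> real) \<Rightarrow> 'p::finite set \<Rightarrow> 'p set \<Rightarrow> bool" where
  "smallest_in m f A T \<longleftrightarrow> T \<subseteq> A \<and> card T = m \<and> (\<forall>i\<in>T. \<forall>j\<in>A - T. f i \<le> f j)"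

definition best_sparse_approx :: "nat \<Rightarrow> real^'p \<Rightarrow> real^'p \<Rightarrow> bool" where
  "best_sparse_approx K a b \<longleftrightarrow>
     (\<exists>T. largest_in K (\<lambda>j. \<bar>a $ j\<bar>) UNIV T \<and> b = (\<chi> j. if j \<in> T then a $ j else 0))"

definition identification_score :: "real^'p^'n \<Rightarrow> 'p set \<Rightarrow> real^'n \<Rightarrow> 'p \<Rightarrow> real" where
  "identification_score X S r j =
     (r \<bullet> column j X)\<^sup>2 /
     (column j X \<bullet>
       ((mat 1 - sub_cols X S ** gram_inv X S ** transpose (sub_cols X S)) *v column j X))"

definition elimination_score :: "real^'p^'n \<Rightarrow> real^'n \<Rightarrow> 'p set \<Rightarrow> 'p \<Rightarrow> real" where
  "elimination_score X y U j =
     (let XU = sub_cols X U; C = gram_inv X U; e = axis j 1;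
          E = id_on U - outer e e
      in y \<bullet> ((XU ** E ** (C - (C ** outer e e ** C) /\<^sub>R (e \<bullet> (C *v e))) ** E ** transpose XU) *v y))"

definition cosaop_run ::
  "nat \<Rightarrow> real^'p^'n \<Rightarrow> real^'n \<Rightarrow> (nat \<Rightarrow> 'p set) \<Rightarrow> (nat \<Rightarrow> 'p set) \<Rightarrow> (nat \<Rightarrow> 'p set) \<Rightarrow>
   (nat \<Rightarrow> real^'p) \<Rightarrow> (nat \<Rightarrow> real^'p) \<Rightarrow> (nat \<Rightarrow> real^'n) \<Rightarrow> bool" where
  "cosaop_run K X y S \<Omega> U a \<beta> r \<longleftrightarrow>
     S 0 = {} \<and> \<beta> 0 = 0 \<and> r 1 = y \<and>
     (\<forall>k\<ge>1.
        largest_in (2 * K) (identification_score X (S (k - 1)) (r k)) (- S (k - 1)) (\<Omega> k) \<and>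
        U k = S (k - 1) \<union> \<Omega> k \<and>
        a k = least_squares X y (U k) \<and>
        smallest_in K (elimination_score X y (U k)) (U k) (S k) \<and>
        \<beta> k = least_squares X y (S k) \<and>
        r (k + 1) = y - X *v \<beta> k)"

end

theory Submission
  imports Defs
begin

text \<open>
  Write \<open>b\<close> for an iterate supported on \<open>S\<close>, \<open>z = \<beta>s - b\<close> for its error and \<open>d\<close> for a restricted
  isometry constant of order \<open>4 * K\<close>. The residual is \<open>X z + \<epsilon>\<close>, and since the Gram matrix of \<open>X\<close> is
  almost the identity on sparse vectors, the correlations of the residual with the columns of \<open>X\<close>
  nearly reproduce \<open>z\<close>: on every index set \<open>B\<close> for which \<open>B \<union> supp z\<close> is small, they differ from \<open>z\<close>
  by at most \<open>\<eta> = d \<parallel>z\<parallel> + sqrt (1 + d) \<parallel>\<epsilon>\<parallel>\<close> in norm (\<open>proxy_error_le\<close>). This one estimate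
  serves twice.

  For least squares on a set \<open>V\<close>, the correlations vanish on \<open>V\<close>, so the part of the error inside
  \<open>V\<close> is at most \<open>\<eta>\<close>, and the whole error is controlled by the part of \<open>\<beta>s\<close> that \<open>V\<close> misses
  (\<open>least_squares_error_le\<close>).

  For identification, the score of a column is its squared correlation divided by the squared
  distance of the column from the span of those already selected. That squared distance lies between
  \<open>1 - d\<close> and \<open>1\<close>, so ranking by score is ranking by correlation up to this factor. A true index
  that is not selected is beaten by a selected false one. On the false ones \<open>z\<close> vanishes, and the
  correlations there have norm at most \<open>\<eta>\<close>; hence the merged set misses little of \<open>\<beta>s\<close> (\<open>identification_missed_le\<close>).

  On \<open>supp \<beta>s\<close> the set kept by elimination is assumed to agree with the support of the best
  sparse approximation \<open>aK\<close> of the least squares estimate \<open>a\<close>, so it misses no more of \<open>\<beta>s\<close> than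
  \<open>aK\<close> does, which is at most \<open>2 \<parallel>a - \<beta>s\<parallel>\<close> (\<open>best_sparse_approx_missed_le\<close>).
  A last application of the least squares bound then yields, for \<open>d = 1/10\<close>, a contraction factor
  of about \<open>0.51\<close> and a noise factor of about \<open>9.1\<close>, well inside the claimed constants.
\<close>

section \<open>Restricted vectors and restricted isometries\<close>

definition restrict_to :: "'p set \<Rightarrow> real^'p \<Rightarrow> real^'p" where
  "restrict_to A v = (\<chi> j. if j \<in> A then v $ j else 0)"

lemma restrict_to_nth [simp]: "restrict_to A v $ j = (if j \<in> A then v $ j else 0)"
  by (simp add: restrict_to_def)

lemma supp_restrict_to: "supp (restrict_to A v) \<subseteq> A"
  by (auto simp: supp_def)

lemma restrict_to_restrict_to [simp]: "restrict_to A (restrict_to B v) = restrict_to (A \<inter> B) v"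
  by (simp add: vec_eq_iff)

lemma restrict_to_empty [simp]: "restrict_to {} v = 0"
  by (simp add: vec_eq_iff)

lemma restrict_to_add: "restrict_to A (u + v) = restrict_to A u + restrict_to A v"
  by (simp add: vec_eq_iff)

lemma restrict_to_split: "v = restrict_to A v + restrict_to (- A) v"
  by (simp add: vec_eq_iff)

lemma restrict_to_cong: "(\<And>j. j \<in> A \<Longrightarrow> u $ j = v $ j) \<Longrightarrow> restrict_to A u = restrict_to A v"
  by (simp add: vec_eq_iff)

lemma inner_restrict_to: "restrict_to A u \<bullet> v = (\<Sum>j\<in>A. u $ j * v $ j)"
  by (simp add: inner_vec_def if_distrib[where f = "\<lambda>t. t * _"] sum.If_cases)

lemma norm_restrict_to_power2: "(norm (restrict_to A v))\<^sup>2 = (\<Sum>j\<in>A. (v $ j)\<^sup>2)"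
  unfolding power2_norm_eq_inner inner_restrict_to by (simp add: power2_eq_square)

lemma norm_restrict_to_le: "norm (restrict_to A v) \<le> norm v"
  by (rule norm_le_componentwise_cart) simp

lemma sparse_vec_subset:
  assumes "supp v \<subseteq> A" and "card A \<le> m"
  shows "sparse_vec m v"
  using assms card_mono[of A "supp v"] by (simp add: sparse_vec_def)

definition satisfies_rip :: "real \<Rightarrow> nat \<Rightarrow> real^'p^'n \<Rightarrow> bool" where
  "satisfies_rip d m X \<longleftrightarrow> (\<forall>x. sparse_vec m x \<longrightarrow>
     (1 - d) * (norm x)\<^sup>2 \<le> (norm (X *v x))\<^sup>2 \<and> (norm (X *v x))\<^sup>2 \<le> (1 + d) * (norm x)\<^sup>2)"

lemma satisfies_ripD:
  assumes "satisfies_rip d m X" "sparse_vec m x"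
  shows "(1 - d) * (norm x)\<^sup>2 \<le> (norm (X *v x))\<^sup>2" "(norm (X *v x))\<^sup>2 \<le> (1 + d) * (norm x)\<^sup>2"
  using assms by (auto simp: satisfies_rip_def)

lemma satisfies_rip_mono:
  fixes X :: "real^'p^'n"
  assumes "satisfies_rip d m X" "d \<le> d'"
  shows "satisfies_rip d' m X"
  unfolding satisfies_rip_def
proof (intro allI impI conjI)
  fix x :: "real^'p" assume x: "sparse_vec m x"
  have "(1 - d') * (norm x)\<^sup>2 \<le> (1 - d) * (norm x)\<^sup>2" "(1 + d) * (norm x)\<^sup>2 \<le> (1 + d') * (norm x)\<^sup>2"
    using assms(2) by (simp_all add: mult_right_mono)
  then show "(1 - d') * (norm x)\<^sup>2 \<le> (norm (X *v x))\<^sup>2" "(norm (X *v x))\<^sup>2 \<le> (1 + d') * (norm x)\<^sup>2"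
    using satisfies_ripD[OF assms(1) x] by linarith+
qed

lemma inner_matrix_mult:
  fixes X :: "real^'p^'n"
  shows "(X *v u) \<bullet> v = u \<bullet> (v v* X)"
  by (metis dot_lmul_matrix inner_commute)

text \<open>The least constant is attained: the admissible constants form a nonempty set, closed because
  it is cut out by non-strict inequalities, and bounded below because, for positive order, a basis
  vector is sparse enough to be tested.\<close>

lemma satisfies_rip_ric:
  fixes X :: "real^'p^'n"
  assumes "m > 0"
  shows "satisfies_rip (ric X m) m X"
proof -
  define D where "D = {d. satisfies_rip d m X}"
  obtain B where B: "\<And>x. norm (X *v x) \<le> norm x * B"
    using bounded_linear.bounded[OF matrix_vector_mul_bounded_linear] by blast
  have "satisfies_rip (1 + B\<^sup>2) m X"
    unfolding satisfies_rip_def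
  proof (intro allI impI conjI)
    fix x :: "real^'p"
    have "(norm (X *v x))\<^sup>2 \<le> (norm x * B)\<^sup>2"
      by (intro power_mono B) simp
    also have "\<dots> \<le> (1 + (1 + B\<^sup>2)) * (norm x)\<^sup>2"
      by (simp add: power_mult_distrib algebra_simps)
    finally show "(norm (X *v x))\<^sup>2 \<le> (1 + (1 + B\<^sup>2)) * (norm x)\<^sup>2" .
    have "(1 - (1 + B\<^sup>2)) * (norm x)\<^sup>2 \<le> 0" by (simp add: mult_nonneg_nonneg)
    then show "(1 - (1 + B\<^sup>2)) * (norm x)\<^sup>2 \<le> (norm (X *v x))\<^sup>2"
      by (rule order_trans) simp
  qed
  then have nonempty: "D \<noteq> {}" by (auto simp: D_def)
  have lower: "1 - (norm (X *v x))\<^sup>2 / (norm x)\<^sup>2 \<le> d" "(norm (X *v x))\<^sup>2 / (norm x)\<^sup>2 - 1 \<le> d"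
    if "d \<in> D" "sparse_vec m x" "x \<noteq> 0" for d x
    using satisfies_ripD[of d m X x] that by (simp_all add: D_def field_simps)
  have least: "satisfies_rip (Inf D) m X"
    unfolding satisfies_rip_def
  proof (intro allI impI)
    fix x :: "real^'p" assume x: "sparse_vec m x"
    show "(1 - Inf D) * (norm x)\<^sup>2 \<le> (norm (X *v x))\<^sup>2 \<and> (norm (X *v x))\<^sup>2 \<le> (1 + Inf D) * (norm x)\<^sup>2"
    proof (cases "x = 0")
      case False
      have "1 - (norm (X *v x))\<^sup>2 / (norm x)\<^sup>2 \<le> Inf D" "(norm (X *v x))\<^sup>2 / (norm x)\<^sup>2 - 1 \<le> Inf D"
        using lower x False by (auto intro!: cInf_greatest[OF nonempty])
      then show ?thesis using False by (simp add: field_simps)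
    next
      case True
      then show ?thesis by (simp add: matrix_vector_mult_0_right)
    qed
  qed
  have "bdd_below D"
  proof -
    fix j :: 'p
    have "supp (axis j 1 :: real^'p) = {j}" by (auto simp: supp_def axis_def)
    then have "sparse_vec m (axis j 1 :: real^'p)" using assms by (simp add: sparse_vec_def)
    then show ?thesis using lower(1)[of _ "axis j 1"] by (intro bdd_belowI) auto
  qed
  then have "(LEAST d. satisfies_rip d m X) = Inf D"
    using least by (intro Least_equality) (auto simp: D_def intro: cInf_lower)
  then show ?thesis
    using least by (simp add: D_def ric_def satisfies_rip_def)
qed

text \<open>Polarization: for unit vectors, four times the left-hand side is the isometry defect of
  \<open>u + v\<close> minus that of \<open>u - v\<close>, hence at most
  \<open>d (\<parallel>u + v\<parallel>\<^sup>2 + \<parallel>u - v\<parallel>\<^sup>2) = 4 d\<close>. Disjoint supports are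
  the special case in which the columns are almost orthogonal.\<close>

lemma rip_inner_le:
  fixes X :: "real^'p^'n"
  assumes rip: "satisfies_rip d m X" and card: "card (supp u \<union> supp v) \<le> m"
  shows "(X *v u) \<bullet> (X *v v) - u \<bullet> v \<le> d * norm u * norm v"
proof (cases "u = 0 \<or> v = 0")
  case False
  define u' v' where "u' = u /\<^sub>R norm u" and "v' = v /\<^sub>R norm v"
  have unit: "norm u' = 1" "norm v' = 1"
    using False by (simp_all add: u'_def v'_def)
  have sparse: "sparse_vec m (u' + v')" "sparse_vec m (u' - v')"
    using card by (auto intro!: sparse_vec_subset[of _ "supp u \<union> supp v"] simp: u'_def v'_def supp_def)
  have "(norm (X *v (u' + v')))\<^sup>2 \<le> (1 + d) * (norm (u' + v'))\<^sup>2"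
       "(1 - d) * (norm (u' - v'))\<^sup>2 \<le> (norm (X *v (u' - v')))\<^sup>2"
    using satisfies_ripD[OF rip sparse(1)] satisfies_ripD[OF rip sparse(2)] by auto
  moreover have "u' \<bullet> u' = 1" "v' \<bullet> v' = 1"
    using unit by (simp_all add: norm_eq_1)
  ultimately have "(X *v u') \<bullet> (X *v v') - u' \<bullet> v' \<le> d"
    by (simp add: power2_norm_eq_inner matrix_vector_right_distrib matrix_vector_mult_diff_distrib
        inner_simps inner_commute algebra_simps)
  moreover have "u = norm u *\<^sub>R u'" "v = norm v *\<^sub>R v'"
    using False by (simp_all add: u'_def v'_def)
  then have "(X *v u) \<bullet> (X *v v) - u \<bullet> v = norm u * norm v * ((X *v u') \<bullet> (X *v v') - u' \<bullet> v')"
    by (metis (no_types, lifting) inner_scaleR_left inner_scaleR_right matrix_vector_mult_scaleR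
        mult.assoc right_diff_distrib)
  ultimately show ?thesis
    using mult_left_mono[of "(X *v u') \<bullet> (X *v v') - u' \<bullet> v'" d "norm u * norm v"]
    by (simp add: mult_ac)
qed auto

lemma rip_norm_le:
  assumes rip: "satisfies_rip d m X" and "sparse_vec m x"
  shows "norm (X *v x) \<le> sqrt (1 + d) * norm x"
  using real_sqrt_le_mono[OF satisfies_ripD(2)[OF assms]] by (simp add: real_sqrt_mult)

text \<open>Pairing the restricted difference \<open>q\<close> with itself turns its squared norm into
  \<open>(X q \<bullet> X z - q \<bullet> z) + X q \<bullet> \<epsilon>\<close>, and \<open>\<parallel>q\<parallel>\<close> is a factor of the bound on either summand.\<close>

lemma proxy_error_le:
  fixes X :: "real^'p^'n"
  assumes rip: "satisfies_rip d m X" "0 \<le> d" and card: "card (B \<union> supp z) \<le> m"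
  shows "norm (restrict_to B ((X *v z + \<epsilon>) v* X - z)) \<le> d * norm z + sqrt (1 + d) * norm \<epsilon>"
    (is "norm ?q \<le> ?\<eta>")
proof (cases "?q = 0")
  case False
  have "card (supp ?q \<union> supp z) \<le> m"
    using card supp_restrict_to[of B] by (meson Un_mono card_mono finite order.trans subset_refl)
  then have approx: "(X *v ?q) \<bullet> (X *v z) - ?q \<bullet> z \<le> d * norm ?q * norm z"
    by (rule rip_inner_le[OF rip(1)])
  have "sparse_vec m ?q"
    using \<open>card (supp ?q \<union> supp z) \<le> m\<close> by (rule sparse_vec_subset[rotated]) auto
  then have noise: "(X *v ?q) \<bullet> \<epsilon> \<le> sqrt (1 + d) * norm ?q * norm \<epsilon>"
    using norm_cauchy_schwarz[of "X *v ?q" \<epsilon>] rip_norm_le[OF rip(1), of ?q]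
    by (meson mult_right_mono norm_ge_zero order_trans)
  have "(norm ?q)\<^sup>2 = ?q \<bullet> ((X *v z + \<epsilon>) v* X - z)"
    unfolding norm_restrict_to_power2 inner_restrict_to by (simp add: power2_eq_square)
  also have "\<dots> = ((X *v ?q) \<bullet> (X *v z) - ?q \<bullet> z) + (X *v ?q) \<bullet> \<epsilon>"
    by (simp add: inner_diff_right inner_add_right inner_matrix_mult vector_matrix_left_distrib)
  also have "\<dots> \<le> norm ?q * ?\<eta>"
    using approx noise by (simp add: algebra_simps)
  finally have "norm ?q * norm ?q \<le> norm ?q * ?\<eta>" by (simp add: power2_eq_square)
  then show ?thesis using False by (simp only: mult_le_cancel_left) simp
next
  case True
  then show ?thesis using rip(2) by simp
qed

section \<open>Least squares on an index set\<close>

lemma sub_cols_mult_vec: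
  "sub_cols X S *v x = X *v restrict_to S x"
  unfolding vec_eq_iff matrix_vector_mult_def sub_cols_def
  by (auto intro!: sum.cong)

lemma vec_mult_sub_cols:
  "y v* sub_cols X S = restrict_to S (y v* X)"
  by (simp add: vec_eq_iff vector_matrix_mult_def sub_cols_def)

lemma vec_mult_nth: "(y v* X) $ j = column j X \<bullet> y"
  for X :: "real^'p^'n"
  by (simp add: vector_matrix_mult_def column_def inner_vec_def mult.commute)

lemma id_on_mult_vec: "id_on S *v x = restrict_to S x"
  by (simp add: vec_eq_iff matrix_vector_mult_def id_on_def mult_delta_left)

text \<open>The choice in \<open>inverse_on\<close> is meaningful for small sets: filling up the Gram matrix by the
  identity outside \<open>S\<close> gives an injective, hence invertible matrix, which commutes with the
  projection onto the coordinates in \<open>S\<close>, so cutting its inverse down to \<open>S\<close> inverts the Gram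
  matrix there.\<close>

lemma gram_mult_gram_inv:
  fixes X :: "real^'p^'n"
  assumes rip: "satisfies_rip d m X" "d < 1" and card: "card S \<le> m"
  defines "G \<equiv> transpose (sub_cols X S) ** sub_cols X S"
  shows "G ** gram_inv X S = id_on S"
proof -
  define M where "M = G + id_on (- S)"
  have G_vec: "G *v x = restrict_to S ((X *v restrict_to S x) v* X)" for x
    by (simp add: G_def sub_cols_mult_vec vec_mult_sub_cols flip: matrix_vector_mul_assoc)
  have "x = 0" if "M *v x = 0" for x
  proof -
    have sum: "G *v x + restrict_to (- S) x = 0"
      using that by (simp add: M_def matrix_vector_mult_add_rdistrib id_on_mult_vec)
    have off: "x $ j = 0" if "j \<notin> S" for j
      using arg_cong[OF sum, of "\<lambda>v. v $ j"] that by (simp add: G_vec)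
    have on: "((X *v restrict_to S x) v* X) $ j = 0" if "j \<in> S" for j
      using arg_cong[OF sum, of "\<lambda>v. v $ j"] that by (simp add: G_vec)
    have x: "restrict_to S x = x" using off by (simp add: vec_eq_iff)
    have "(norm (X *v x))\<^sup>2 = x \<bullet> ((X *v x) v* X)"
      by (simp add: power2_norm_eq_inner inner_matrix_mult)
    also have "\<dots> = restrict_to S x \<bullet> ((X *v restrict_to S x) v* X)"
      by (simp add: x)
    also have "\<dots> = 0"
      unfolding inner_restrict_to using on by simp
    finally have "(1 - d) * (norm x)\<^sup>2 \<le> 0"
      using satisfies_ripD(1)[OF rip(1) sparse_vec_subset[OF supp_restrict_to card], of x] by (simp add: x)
    then show ?thesis using rip(2) by (simp add: mult_le_0_iff)
  qed
  then have "invertible M"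
    using matrix_left_invertible_ker invertible_left_inverse by blast
  then obtain N where N: "M ** N = mat 1" "N ** M = mat 1"
    by (auto simp: invertible_def)
  have M_vec: "M *v x = G *v x + restrict_to (- S) x" for x
    by (simp add: M_def matrix_vector_mult_add_rdistrib id_on_mult_vec)
  have idem: "id_on S ** id_on S = id_on S"
    by (simp add: matrix_eq id_on_mult_vec flip: matrix_vector_mul_assoc)
  have M_id: "M ** id_on S = G"
    by (simp add: matrix_eq M_vec G_vec id_on_mult_vec flip: matrix_vector_mul_assoc)
  have id_M: "id_on S ** M = G"
    by (simp add: matrix_eq M_vec G_vec id_on_mult_vec restrict_to_add flip: matrix_vector_mul_assoc)
  have commute: "N ** id_on S = id_on S ** N"
  proof -
    have "N ** id_on S = N ** (id_on S ** M) ** N"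
      by (simp add: N(1) flip: matrix_mul_assoc)
    also have "\<dots> = N ** (M ** id_on S) ** N"
      by (simp only: id_M M_id)
    also have "\<dots> = (N ** M) ** id_on S ** N"
      by (simp only: matrix_mul_assoc)
    finally show ?thesis by (simp add: N(2))
  qed
  define C where "C = N ** id_on S"
  have zero: "C $ i $ j = 0" if "i \<notin> S \<or> j \<notin> S" for i j
  proof (cases "i \<in> S")
    case True
    then show ?thesis using that by (auto simp: C_def matrix_matrix_mult_def id_on_def intro!: sum.neutral)
  next
    case False
    then show ?thesis unfolding C_def commute by (simp add: matrix_matrix_mult_def id_on_def)
  qed
  have "G ** C = M ** (id_on S ** id_on S) ** N"
    unfolding C_def commute M_id[symmetric] by (simp add: matrix_mul_assoc)
  also have "\<dots> = M ** N ** id_on S"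
    unfolding idem by (simp add: commute flip: matrix_mul_assoc)
  finally have right: "G ** C = id_on S" by (simp add: N(1))
  have "C ** G = N ** (id_on S ** id_on S) ** M"
    unfolding C_def id_M[symmetric] by (simp add: matrix_mul_assoc)
  also have "\<dots> = id_on S ** (N ** M)"
    unfolding idem commute by (simp add: matrix_mul_assoc)
  finally have left: "C ** G = id_on S" by (simp add: N(2))
  let ?P = "\<lambda>C. (\<forall>i j. i \<notin> S \<or> j \<notin> S \<longrightarrow> C $ i $ j = 0) \<and> G ** C = id_on S \<and> C ** G = id_on S"
  have "?P C" using zero right left by blast
  then have "?P (SOME C. ?P C)" by (rule someI[of ?P])
  then show ?thesis
    unfolding gram_inv_def inverse_on_def G_def by blast
qed

lemma supp_least_squares: "supp (least_squares X y S) \<subseteq> S"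
  by (auto simp: least_squares_def supp_def)

lemma least_squares_orthogonal:
  fixes X :: "real^'p^'n"
  assumes rip: "satisfies_rip d m X" "d < 1" and card: "card S \<le> m" and j: "j \<in> S"
  shows "column j X \<bullet> (y - X *v least_squares X y S) = 0"
proof -
  let ?C = "gram_inv X S" and ?G = "transpose (sub_cols X S) ** sub_cols X S"
  let ?b = "least_squares X y S"
  have "?b = restrict_to S (?C *v restrict_to S (y v* X))"
    by (simp add: least_squares_def vec_eq_iff vec_mult_sub_cols)
  then have "restrict_to S ((X *v ?b) v* X) = ?G *v (?C *v restrict_to S (y v* X))"
    by (simp add: sub_cols_mult_vec vec_mult_sub_cols flip: matrix_vector_mul_assoc)
  also have "\<dots> = restrict_to S (restrict_to S (y v* X))"
    using gram_mult_gram_inv[OF rip card] by (simp add: matrix_vector_mul_assoc id_on_mult_vec)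
  finally have "restrict_to S ((X *v ?b) v* X) $ j
      = restrict_to S (restrict_to S (y v* X)) $ j" by simp
  then show ?thesis using j by (simp add: vec_mult_nth inner_diff_right)
qed

text \<open>By orthogonality the correlations of the residual vanish on \<open>S\<close>, so \<open>proxy_error_le\<close> bounds
  the error on \<open>S\<close> by \<open>d\<close> times the whole error plus noise; outside \<open>S\<close> the error is \<open>\<beta>s\<close> itself.
  The factor \<open>1 - d\<close> comes from absorbing the first term.\<close>

lemma least_squares_error_le:
  fixes X :: "real^'p^'n"
  assumes rip: "satisfies_rip d m X" "0 \<le> d" "d < 1" and card: "card (S \<union> supp \<beta>s) \<le> m"
    and y: "y = X *v \<beta>s + \<epsilon>"
  shows "(1 - d) * norm (least_squares X y S - \<beta>s)
    \<le> norm (restrict_to (- S) \<beta>s) + sqrt (1 + d) * norm \<epsilon>"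
proof -
  define b where "b = least_squares X y S"
  define z where "z = \<beta>s - b"
  have supp_b: "supp b \<subseteq> S" by (simp add: b_def supp_least_squares)
  have "S \<union> supp z \<subseteq> S \<union> supp \<beta>s"
    using supp_b by (auto simp: supp_def z_def)
  then have card_z: "card (S \<union> supp z) \<le> m"
    using card by (meson card_mono finite order_trans)
  have card_S: "card S \<le> m"
    using card card_mono[of "S \<union> supp \<beta>s" S] by simp
  have residual: "X *v z + \<epsilon> = y - X *v b"
    by (simp add: y z_def matrix_vector_mult_diff_distrib)
  have "restrict_to S ((X *v z + \<epsilon>) v* X - z) = - restrict_to S z"
    unfolding vec_eq_iff
    using least_squares_orthogonal[OF rip(1,3) card_S] by (simp add: residual vec_mult_nth b_def)
  then have "norm (restrict_to S z) \<le> d * norm z + sqrt (1 + d) * norm \<epsilon>"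
    using proxy_error_le[OF rip(1,2) card_z, of \<epsilon>] by simp
  moreover have "restrict_to (- S) z = restrict_to (- S) \<beta>s"
    using supp_b by (intro restrict_to_cong) (auto simp: z_def supp_def)
  then have "norm z \<le> norm (restrict_to S z) + norm (restrict_to (- S) \<beta>s)"
    by (metis norm_triangle_ineq restrict_to_split)
  ultimately show ?thesis
    by (simp add: z_def b_def norm_minus_commute algebra_simps)
qed

section \<open>Selecting the largest entries\<close>

text \<open>\<open>Q - T\<close> has no more elements than \<open>T - Q\<close>, so its elements can be matched injectively with
  elements of \<open>T - Q\<close>, each of which has the larger value.\<close>

lemma largest_in_sum_le:
  fixes f :: "'p::finite \<Rightarrow> real"
  assumes T: "largest_in m f A T" and Q: "Q \<subseteq> A" "card Q \<le> m" and nonneg: "\<And>j. j \<in> T \<Longrightarrow> 0 \<le> f j"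
  shows "sum f (Q - T) \<le> sum f (T - Q)"
proof -
  have "card (Q - T) \<le> card (T - Q)"
    using T Q(2) by (simp add: largest_in_def card_Diff_subset_Int Int_commute diff_le_mono)
  then obtain g where g: "g ` (Q - T) \<subseteq> T - Q" "inj_on g (Q - T)"
    using card_le_inj[of "Q - T" "T - Q"] by auto
  have "sum f (Q - T) \<le> (\<Sum>j\<in>Q - T. f (g j))"
  proof (rule sum_mono)
    fix j assume "j \<in> Q - T"
    then have "j \<in> A - T" "g j \<in> T" using Q(1) g(1) by auto
    then show "f j \<le> f (g j)" using T by (auto simp: largest_in_def)
  qed
  also have "\<dots> = sum f (g ` (Q - T))"
    using g(2) by (simp add: sum.reindex)
  also have "\<dots> \<le> sum f (T - Q)"
    using g(1) nonneg by (intro sum_mono2) auto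
  finally show ?thesis .
qed

text \<open>Both errors contain the entries of \<open>a\<close> outside \<open>T \<union> supp x\<close>; apart from these, \<open>b\<close> loses
  those in \<open>supp x - T\<close> and \<open>x\<close> at least those in the larger part \<open>T - supp x\<close>.\<close>

lemma best_sparse_approx_norm_le:
  fixes a :: "real^'p"
  assumes approx: "best_sparse_approx K a b" and sparse: "sparse_vec K x"
  shows "norm (a - b) \<le> norm (a - x)"
proof -
  obtain T where T: "largest_in K (\<lambda>j. \<bar>a $ j\<bar>) UNIV T" and b: "b = (\<chi> j. if j \<in> T then a $ j else 0)"
    using approx by (auto simp: best_sparse_approx_def)
  have T2: "largest_in K (\<lambda>j. (a $ j)\<^sup>2) UNIV T"
    using T by (simp add: largest_in_def abs_le_square_iff)
  have cmp: "(\<Sum>j\<in>supp x - T. (a $ j)\<^sup>2) \<le> (\<Sum>j\<in>T - supp x. (a $ j)\<^sup>2)"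
    using largest_in_sum_le[OF T2, of "supp x"] sparse by (simp add: sparse_vec_def)
  have "(norm (a - b))\<^sup>2 = (norm (restrict_to (- T) a))\<^sup>2"
    by (rule arg_cong[where f = "\<lambda>v. (norm v)\<^sup>2"]) (simp add: b vec_eq_iff)
  also have "\<dots> = (\<Sum>j\<in>(supp x - T) \<union> - (supp x \<union> T). (a $ j)\<^sup>2)"
    unfolding norm_restrict_to_power2 by (rule sum.cong) auto
  also have "\<dots> = (\<Sum>j\<in>supp x - T. (a $ j)\<^sup>2) + (\<Sum>j\<in>- (supp x \<union> T). (a $ j)\<^sup>2)"
    by (rule sum.union_disjoint) auto
  also have "\<dots> \<le> (\<Sum>j\<in>T - supp x. (a $ j)\<^sup>2) + (\<Sum>j\<in>- (supp x \<union> T). (a $ j)\<^sup>2)"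
    using cmp by simp
  also have "\<dots> = (\<Sum>j\<in>(T - supp x) \<union> - (supp x \<union> T). (a $ j)\<^sup>2)"
    by (rule sum.union_disjoint[symmetric]) auto
  also have "\<dots> = (norm (restrict_to (- supp x) (a - x)))\<^sup>2"
    unfolding norm_restrict_to_power2 by (rule sum.cong) (auto simp: supp_def)
  also have "\<dots> \<le> (norm (a - x))\<^sup>2"
    by (intro power_mono norm_restrict_to_le) simp
  finally show ?thesis by (simp add: power2_le_iff_abs_le)
qed

text \<open>On \<open>supp \<beta>s\<close>, lying outside \<open>S\<close> means lying outside \<open>supp b\<close>, where \<open>\<beta>s\<close> is part of
  \<open>\<beta>s - b\<close>. The factor \<open>2\<close> comes from the triangle inequality through \<open>a\<close>.\<close>

lemma best_sparse_approx_missed_le: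
  fixes a :: "real^'p"
  assumes approx: "best_sparse_approx K a b" and sparse: "sparse_vec K \<beta>s"
    and agree: "supp \<beta>s \<subseteq> - sym_diff S (supp b)"
  shows "norm (restrict_to (- S) \<beta>s) \<le> 2 * norm (a - \<beta>s)"
proof -
  have "restrict_to (- S) \<beta>s = restrict_to (- S) (restrict_to (- supp b) (\<beta>s - b))"
    using agree by (auto simp: vec_eq_iff supp_def)
  then have "norm (restrict_to (- S) \<beta>s) \<le> norm (\<beta>s - b)"
    using norm_restrict_to_le order_trans by metis
  also have "\<dots> = norm ((a - b) - (a - \<beta>s))"
    by simp
  also have "\<dots> \<le> norm (a - b) + norm (a - \<beta>s)"
    by (rule norm_triangle_ineq4)
  also have "\<dots> \<le> 2 * norm (a - \<beta>s)"
    using best_sparse_approx_norm_le[OF approx sparse] by simp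
  finally show ?thesis .
qed

section \<open>Identification\<close>

text \<open>The denominator is \<open>\<parallel>q\<parallel>\<^sup>2\<close> for the residual \<open>q\<close> of the regression of column \<open>j\<close> on the
  columns in \<open>S\<close>. By Pythagoras it is at most the squared length of the column; and \<open>q = X v\<close>
  for a sparse vector \<open>v\<close> with entry \<open>1\<close> at \<open>j\<close>, which bounds it from below.\<close>

lemma identification_denominator_bounds:
  fixes X :: "real^'p^'n"
  assumes rip: "satisfies_rip d m X" "d < 1" and card: "card S < m" and j: "j \<notin> S"
    and unit: "column j X \<bullet> column j X = 1"
  defines "D \<equiv> column j X \<bullet>
       ((mat 1 - sub_cols X S ** gram_inv X S ** transpose (sub_cols X S)) *v column j X)"
  shows "1 - d \<le> D" "D \<le> 1"
proof -
  define w where "w = least_squares X (column j X) S"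
  define q where "q = column j X - X *v w"
  have supp_w: "supp w \<subseteq> S" by (simp add: w_def supp_least_squares)
  have "w = restrict_to S (gram_inv X S *v (transpose (sub_cols X S) *v column j X))"
    by (simp add: w_def least_squares_def vec_eq_iff)
  then have D: "D = column j X \<bullet> q"
    by (simp add: D_def q_def matrix_vector_mult_diff_rdistrib sub_cols_mult_vec
        flip: matrix_vector_mul_assoc)
  have "(X *v w) \<bullet> q = w \<bullet> (q v* X)"
    by (rule inner_matrix_mult)
  also have "\<dots> = restrict_to S w \<bullet> (q v* X)"
    using supp_w by (intro arg_cong2[where f = inner]) (auto simp: vec_eq_iff supp_def)
  also have "\<dots> = 0"
    unfolding inner_restrict_to
    using least_squares_orthogonal[OF rip less_imp_le[OF card]]
    by (simp add: vec_mult_nth q_def w_def)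
  finally have orth: "(X *v w) \<bullet> q = 0" .
  have col: "column j X = X *v w + q" by (simp add: q_def)
  have "D = (norm q)\<^sup>2"
    unfolding D by (subst col) (simp add: inner_add_left orth power2_norm_eq_inner)
  have "1 = (norm (X *v w))\<^sup>2 + (norm q)\<^sup>2"
    using unit orth unfolding col by (simp add: inner_simps inner_commute power2_norm_eq_inner)
  then show "D \<le> 1" using \<open>D = (norm q)\<^sup>2\<close> zero_le_power2[of "norm (X *v w)"] by linarith
  have q: "q = X *v (axis j 1 - w)"
    by (simp add: q_def matrix_vector_mult_diff_distrib matrix_vector_mult_basis)
  have "supp (axis j 1 - w) \<subseteq> insert j S"
    using supp_w by (auto simp: supp_def axis_def split: if_splits)
  moreover have "card (insert j S) \<le> m" using card j by simp
  ultimately have "(1 - d) * (norm (axis j 1 - w))\<^sup>2 \<le> D"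
    using satisfies_ripD(1)[OF rip(1) sparse_vec_subset] \<open>D = (norm q)\<^sup>2\<close> q by metis
  moreover have "w $ j = 0" using supp_w j by (auto simp: supp_def)
  then have "1 \<le> norm (axis j 1 - w)"
    using component_le_norm_cart[of "axis j 1 - w" j] by simp
  then have "1 \<le> (norm (axis j 1 - w))\<^sup>2" by simp
  then have "1 - d \<le> (1 - d) * (norm (axis j 1 - w))\<^sup>2"
    using rip(2) mult_left_mono[of 1 "(norm (axis j 1 - w))\<^sup>2" "1 - d"] by simp
  ultimately show "1 - d \<le> D" by linarith
qed

text \<open>With \<open>c\<close> the vector of correlations, the missed true indices \<open>A\<close> and the selected false ones
  \<open>B\<close> satisfy \<open>\<parallel>c\<^sub>A\<parallel> \<le> \<parallel>c\<^sub>B\<parallel> / sqrt (1 - d)\<close> by comparison of scores. Since \<open>z\<close> vanishes on \<open>B\<close>,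
  \<open>c\<^sub>B\<close> is pure proxy error; on \<open>A\<close> a second proxy error is paid for passing from \<open>c\<close> back to
  \<open>z\<close>, which equals \<open>\<beta>s\<close> there. The order \<open>4 * K\<close> is the size of \<open>S \<union> supp \<beta>s \<union> \<Omega>\<close> at most.\<close>

lemma identification_missed_le:
  fixes X :: "real^'p^'n"
  assumes rip: "satisfies_rip d (4 * K) X" "0 \<le> d" "d < 1" and K: "K > 0"
    and unit: "\<And>j. column j X \<bullet> column j X = 1"
    and sparse: "sparse_vec K \<beta>s" and supp_b: "supp b \<subseteq> S" and card: "card S \<le> K"
    and y: "y = X *v \<beta>s + \<epsilon>"
    and \<Omega>: "largest_in (2 * K) (identification_score X S (y - X *v b)) (- S) \<Omega>"
  shows "norm (restrict_to (- (S \<union> \<Omega>)) \<beta>s)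
    \<le> (1 + 1 / sqrt (1 - d)) * (d * norm (b - \<beta>s) + sqrt (1 + d) * norm \<epsilon>)"
proof -
  define z where "z = \<beta>s - b"
  define c where "c = (y - X *v b) v* X"
  define \<eta> where "\<eta> = d * norm z + sqrt (1 + d) * norm \<epsilon>"
  define A where "A = supp \<beta>s - S - \<Omega>"
  define B where "B = \<Omega> - supp \<beta>s"
  have \<Omega>_S: "\<Omega> \<subseteq> - S" "card \<Omega> = 2 * K"
    using \<Omega> by (auto simp: largest_in_def)
  have supp_z: "supp z \<subseteq> S \<union> supp \<beta>s"
    using supp_b by (auto simp: z_def supp_def)
  have residual: "y - X *v b = X *v z + \<epsilon>"
    by (simp add: y z_def matrix_vector_mult_diff_distrib)
  have proxy: "norm (restrict_to I (c - z)) \<le> \<eta>" if "I \<subseteq> S \<union> supp \<beta>s \<union> \<Omega>" for I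
  proof -
    have "card (S \<union> supp \<beta>s \<union> \<Omega>) \<le> card S + card (supp \<beta>s) + card \<Omega>"
      by (meson add_right_mono card_Un_le order_trans)
    also have "\<dots> \<le> 4 * K" using card sparse \<Omega>_S(2) by (simp add: sparse_vec_def)
    finally have "card (S \<union> supp \<beta>s \<union> \<Omega>) \<le> 4 * K" .
    moreover have "I \<union> supp z \<subseteq> S \<union> supp \<beta>s \<union> \<Omega>" using that supp_z by blast
    ultimately have "card (I \<union> supp z) \<le> 4 * K"
      by (meson card_mono finite order_trans)
    then show ?thesis
      unfolding c_def \<eta>_def residual by (rule proxy_error_le[OF rip(1,2)])
  qed
  define D where "D j = column j X \<bullet>
       ((mat 1 - sub_cols X S ** gram_inv X S ** transpose (sub_cols X S)) *v column j X)" for j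
  have D: "1 - d \<le> D j" "D j \<le> 1" if "j \<notin> S" for j
    using identification_denominator_bounds[OF rip(1,3), of S j] card K that unit by (simp_all add: D_def)
  have score: "identification_score X S (y - X *v b) j = (c $ j)\<^sup>2 / D j" for j
    by (simp add: identification_score_def c_def D_def vec_mult_nth inner_commute)
  have D_pos: "0 < D j" if "j \<notin> S" for j using D[OF that] rip(3) by simp
  have "(norm (restrict_to A c))\<^sup>2 = (\<Sum>j\<in>A. (c $ j)\<^sup>2)"
    by (rule norm_restrict_to_power2)
  also have "\<dots> \<le> (\<Sum>j\<in>A. (c $ j)\<^sup>2 / D j)"
  proof (rule sum_mono)
    fix j assume "j \<in> A"
    then have "j \<notin> S" by (simp add: A_def)
    then show "(c $ j)\<^sup>2 \<le> (c $ j)\<^sup>2 / D j"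
      using D[of j] D_pos[of j] by (simp add: le_divide_eq mult_left_le)
  qed
  also have "\<dots> \<le> (\<Sum>j\<in>B. (c $ j)\<^sup>2 / D j)"
  proof -
    have "card (supp \<beta>s - S) \<le> 2 * K"
      using sparse card_mono[of "supp \<beta>s" "supp \<beta>s - S"] by (auto simp: sparse_vec_def)
    moreover have "0 \<le> (c $ j)\<^sup>2 / D j" if "j \<in> \<Omega>" for j
      using D_pos[of j] that \<Omega>_S by (simp add: subset_iff)
    moreover have "\<Omega> - (supp \<beta>s - S) = B" using \<Omega>_S by (auto simp: B_def)
    ultimately show ?thesis
      using largest_in_sum_le[OF \<Omega>, of "supp \<beta>s - S"] by (auto simp: score A_def)
  qed
  also have "\<dots> \<le> (\<Sum>j\<in>B. (c $ j)\<^sup>2 / (1 - d))"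
  proof (rule sum_mono)
    fix j assume "j \<in> B"
    then have "j \<notin> S" using \<Omega>_S by (auto simp: B_def)
    then show "(c $ j)\<^sup>2 / D j \<le> (c $ j)\<^sup>2 / (1 - d)"
      using D[of j] rip(3) by (intro divide_left_mono) auto
  qed
  also have "\<dots> = (norm (restrict_to B c) / sqrt (1 - d))\<^sup>2"
    using rip(3) by (simp add: norm_restrict_to_power2 power_divide flip: sum_divide_distrib)
  finally have "norm (restrict_to A c) \<le> norm (restrict_to B c) / sqrt (1 - d)"
    by (rule power2_le_imp_le) (use rip(3) in simp)
  also have "\<dots> \<le> \<eta> / sqrt (1 - d)"
  proof -
    have "restrict_to B (c - z) = restrict_to B c"
      using supp_z \<Omega>_S by (intro restrict_to_cong) (auto simp: B_def supp_def)
    then show ?thesis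
      using proxy[of B] rip(3) by (intro divide_right_mono) (auto simp: B_def)
  qed
  finally have A_c: "norm (restrict_to A c) \<le> \<eta> / sqrt (1 - d)" .
  have "restrict_to (- (S \<union> \<Omega>)) \<beta>s = restrict_to A c - restrict_to A (c - z)"
    using supp_b by (auto simp: vec_eq_iff A_def z_def supp_def)
  then have "norm (restrict_to (- (S \<union> \<Omega>)) \<beta>s) \<le> norm (restrict_to A c) + norm (restrict_to A (c - z))"
    by (metis norm_triangle_ineq4)
  also have "\<dots> \<le> \<eta> / sqrt (1 - d) + \<eta>"
    using A_c proxy[of A] unfolding A_def by (intro add_mono) auto
  finally show ?thesis
    by (simp add: \<eta>_def z_def norm_minus_commute distrib_right add.commute)
qed

section \<open>Linear convergence\<close>

lemma cosaop_run_invariants: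
  assumes run: "cosaop_run K X y S \<Omega> U a \<beta> r"
  shows "card (S k) \<le> K" "supp (\<beta> k) \<subseteq> S k" "r (k + 1) = y - X *v \<beta> k"
proof -
  have "card (S k) \<le> K \<and> supp (\<beta> k) \<subseteq> S k \<and> r (k + 1) = y - X *v \<beta> k"
  proof (cases "k \<ge> 1")
    case True
    then show ?thesis
      using run supp_least_squares[of X y "S k"] by (auto simp: cosaop_run_def smallest_in_def)
  next
    case False
    then have "k = 0" by simp
    then show ?thesis
      using run by (simp add: cosaop_run_def supp_def)
  qed
  then show "card (S k) \<le> K" "supp (\<beta> k) \<subseteq> S k" "r (k + 1) = y - X *v \<beta> k" by auto
qed

theorem theorem4p9:
  fixes X :: "real^'p^'n" and y \<epsilon> :: "real^'n" and \<beta>s :: "real^'p" and K :: nat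
    and S \<Omega> U :: "nat \<Rightarrow> 'p set" and a aK \<beta> :: "nat \<Rightarrow> real^'p" and r :: "nat \<Rightarrow> real^'n"
  assumes model: "y = X *v \<beta>s + \<epsilon>"
    and sparse: "sparse_vec K \<beta>s"
    and unit_columns: "\<And>j. column j X \<bullet> column j X = 1"
    and rip: "ric X K \<le> ric X (K + 1)" "ric X (K + 1) \<le> ric X (2 * K)"
             "ric X (2 * K) \<le> ric X (4 * K)" "ric X (4 * K) \<le> 0.1"
    and run: "cosaop_run K X y S \<Omega> U a \<beta> r"
    and approx: "\<And>k. k \<ge> 1 \<Longrightarrow> best_sparse_approx K (a k) (aK k)"
    and agree: "\<And>k. k \<ge> 1 \<Longrightarrow> supp \<beta>s \<subseteq> - sym_diff (S k) (supp (aK k))"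
  shows "\<forall>k\<ge>1. norm (\<beta> k - \<beta>s) \<le> 0.869 * norm (\<beta> (k - 1) - \<beta>s) + 14.482 * norm \<epsilon>"
proof (intro allI impI)
  fix k :: nat assume k: "k \<ge> 1"
  note supports = cosaop_run_invariants[OF run]
  show "norm (\<beta> k - \<beta>s) \<le> 0.869 * norm (\<beta> (k - 1) - \<beta>s) + 14.482 * norm \<epsilon>"
    \<comment> \<open>For \<open>K = 0\<close> the restricted isometry constants carry no information.\<close>
  proof (cases "K = 0")
    case True
    have "S k = {}" using supports(1)[of k] True by simp
    then have "\<beta> k = 0" using supports(2)[of k] by (simp add: vec_eq_iff supp_def)
    moreover have "\<beta>s = 0" using sparse True by (simp add: vec_eq_iff sparse_vec_def supp_def)
    ultimately show ?thesis by simp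
  next
    case False
    then have K: "K > 0" by simp
    have iteration: "largest_in (2 * K) (identification_score X (S (k - 1)) (r k)) (- S (k - 1)) (\<Omega> k)"
        "U k = S (k - 1) \<union> \<Omega> k" "a k = least_squares X y (U k)" "\<beta> k = least_squares X y (S k)"
      using run k by (auto simp: cosaop_run_def)
    have card_supp: "card (supp \<beta>s) \<le> K" using sparse by (simp add: sparse_vec_def)
    have X: "satisfies_rip (1/10) (4 * K) X"
      using satisfies_rip_mono[OF satisfies_rip_ric[of "4 * K" X]] rip(4) K by simp
    define \<rho> where "\<rho> = norm (\<beta> (k - 1) - \<beta>s)"
    \<comment> \<open>Rational bounds; their slack is affordable because the constants to be reached are generous.\<close>
    have sqrts: "sqrt (1 + 1/10) \<le> 21/20" "1 / sqrt (1 - 1/10) \<le> (53/50::real)"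
    proof -
      show "sqrt (1 + 1/10) \<le> (21/20::real)" by (rule real_le_lsqrt) (auto simp: power2_eq_square)
      have "50/53 \<le> sqrt (1 - 1/10::real)" by (rule real_le_rsqrt) (auto simp: power2_eq_square)
      then have "1 \<le> 53/50 * sqrt (1 - 1/10::real)" by simp
      then show "1 / sqrt (1 - 1/10) \<le> (53/50::real)" by (simp add: divide_le_eq)
    qed
    have noise: "sqrt (1 + 1/10) * norm \<epsilon> \<le> 21/20 * norm \<epsilon>"
      using sqrts(1) by (rule mult_right_mono) simp
    have "norm (restrict_to (- U k) \<beta>s)
        \<le> (1 + 1 / sqrt (1 - 1/10)) * (1/10 * \<rho> + sqrt (1 + 1/10) * norm \<epsilon>)"
      unfolding iteration(2) \<rho>_def
      using iteration(1) supports(3)[of "k - 1"] k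
      by (intro identification_missed_le[OF X _ _ K unit_columns sparse supports(2) supports(1) model]) auto
    also have "\<dots> \<le> 103/50 * (1/10 * \<rho> + 21/20 * norm \<epsilon>)"
      using sqrts(2) noise by (intro mult_mono) (auto simp: \<rho>_def)
    finally have missed: "norm (restrict_to (- U k) \<beta>s) \<le> 103/50 * (1/10 * \<rho> + 21/20 * norm \<epsilon>)" .
    have least_squares_error:
      "(1 - 1/10) * norm (least_squares X y V - \<beta>s) \<le> norm (restrict_to (- V) \<beta>s) + 21/20 * norm \<epsilon>"
      if "card (V \<union> supp \<beta>s) \<le> 4 * K" for V
      by (rule order_trans[OF least_squares_error_le[OF X _ _ that model] add_left_mono[OF noise]]) auto
    have "card (U k \<union> supp \<beta>s) \<le> card (S (k - 1)) + card (\<Omega> k) + card (supp \<beta>s)"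
      unfolding iteration(2) by (meson add_right_mono card_Un_le order_trans)
    also have "\<dots> \<le> 4 * K"
      using supports(1)[of "k - 1"] iteration(1) card_supp by (simp add: largest_in_def)
    finally have "(1 - 1/10) * norm (a k - \<beta>s) \<le> norm (restrict_to (- U k) \<beta>s) + 21/20 * norm \<epsilon>"
      unfolding iteration(3) by (rule least_squares_error)
    moreover have nonneg: "0 \<le> \<rho>" "0 \<le> norm \<epsilon>" by (auto simp: \<rho>_def)
    ultimately have merged: "norm (a k - \<beta>s) \<le> 229/1000 * \<rho> + 357/100 * norm \<epsilon>"
      using missed by argo
    have "card (S k \<union> supp \<beta>s) \<le> 4 * K"
      using card_Un_le[of "S k" "supp \<beta>s"] supports(1)[of k] card_supp by linarith
    then have "(1 - 1/10) * norm (\<beta> k - \<beta>s) \<le> norm (restrict_to (- S k) \<beta>s) + 21/20 * norm \<epsilon>"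
      unfolding iteration(4) by (rule least_squares_error)
    moreover have "norm (restrict_to (- S k) \<beta>s) \<le> 2 * norm (a k - \<beta>s)"
      by (rule best_sparse_approx_missed_le[OF approx[OF k] sparse agree[OF k]])
    ultimately have "norm (\<beta> k - \<beta>s) \<le> 869/1000 * \<rho> + 14482/1000 * norm \<epsilon>"
      using merged nonneg by argo
    then show ?thesis by (simp add: \<rho>_def)
  qed
qed

end
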